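(* For every $\mathbf{n}=(n_1,n_2,n_3)\in\mathbb{N}_0^3$, the function $\eta^{\mathbf{n}}:\mathbb{H}_0\to\mathbb{H}_0$ defined in the context is a $0$-harmonic $0$-regular function on $\mathbb{H}_0$.
   Context: $\mathbb{H}_0$ (the $0$-scaled hypercomplexes) is the associative unital real algebra with $\mathbb{R}$-basis $\{1,i,j_0,k_0\}$ and multiplication determined by $i^2=-1$, $j_0^2=k_0^2=0$, $ij_0=k_0$, $j_0k_0=0$, $k_0i=j_0$, $j_0i=-k_0$, $ik_0=-j_0$, $k_0j_0=0$. Its elements are written $w=x_1+x_2i+x_3j_0+x_4k_0$ with $x_1,\dots,x_4\in\mathbb{R}$, and $\mathbb{H}_0$ is identified with $\mathbb{R}^4$ for differentiation. $\mathbb{N}_0=\{0,1,2,\dots\}$. A function $f$ is $0$-regular if both $$\nabla_0 f=\frac{\partial f}{\partial x_1}+i\frac{\partial f}{\partial x_2}+j_0\frac{\partial f}{\partial x_3}+k_0\frac{\partial f}{\partial x_4}=0\quad\text{and}\quad f\nabla_0=\frac{\partial f}{\partial x_1}+\frac{\partial f}{\partial x_2}i+\frac{\partial f}{\partial x_3}j_0+\frac{\partial f}{\partial x_4}k_0=0,$$ and $0$-harmonic if $\varDelta_0 f=\frac{\partial^2f}{\partial x_1^2}+\frac{\partial^2f}{\partial x_2^2}=0$. The symmetrized product of functions $f_1,\dots,f_N:\mathbb{H}_0\to\mathbb{H}_0$ is $f_1\times\cdots\times f_N=\frac{1}{N!}\sum_{\sigma\in S_N}f_{\sigma(1)}f_{\sigma(2)}\cdots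 f_{\sigma(N)}$ (pointwise products in $\mathbb{H}_0$). In such a product, $f^{(n)}$ stands for $n$ repeated factors $f$, and $f^{(0)}=1$. Thus $\eta_2^{(n_1)}\times\eta_3^{(n_2)}\times\eta_4^{(n_3)}$ is the symmetrized product of the list of $n_1+n_2+n_3$ functions consisting of $n_1$ copies of $\eta_2$, $n_2$ copies of $\eta_3$ and $n_3$ copies of $\eta_4$ (equal to the constant $1$ if the list is empty). Here $$\eta_2(w)=x_2-x_1i,\quad\eta_3(w)=x_3-x_1j_0,\quad\eta_4(w)=x_4-x_1k_0,$$ and $$\eta^{\mathbf{n}}=\frac{1}{n_1!\,n_2!\,n_3!}\left(\eta_2^{(n_1)}\times\eta_3^{(n_2)}\times\eta_4^{(n_3)}\right).$$ *)

theory Defs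
  imports "HOL-Analysis.Analysis" "HOL-Combinatorics.Permutations"
begin

section \<open>The 0-scaled hypercomplexes\<close>

text \<open>\<open>H0 x1 x2 x3 x4\<close> stands for $x_1 + x_2 i + x_3 j_0 + x_4 k_0$.\<close>

codatatype hyp0 = H0 (X1: real) (X2: real) (X3: real) (X4: real)

lemma hyp0_eqI [intro?]:
  "X1 x = X1 y \<Longrightarrow> X2 x = X2 y \<Longrightarrow> X3 x = X3 y \<Longrightarrow> X4 x = X4 y \<Longrightarrow> x = y"
  by (rule hyp0.expand) simp

lemma hyp0_eq_iff:
  "x = y \<longleftrightarrow> X1 x = X1 y \<and> X2 x = X2 y \<and> X3 x = X3 y \<and> X4 x = X4 y"
  by (metis hyp0.expand)

instantiation hyp0 :: ab_group_add
begin

primcorec zero_hyp0 where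
  "X1 0 = 0" | "X2 0 = 0" | "X3 0 = 0" | "X4 0 = 0"

primcorec plus_hyp0 where
  "X1 (x + y) = X1 x + X1 y"
| "X2 (x + y) = X2 x + X2 y"
| "X3 (x + y) = X3 x + X3 y"
| "X4 (x + y) = X4 x + X4 y"

primcorec uminus_hyp0 where
  "X1 (- x) = - X1 x" | "X2 (- x) = - X2 x" | "X3 (- x) = - X3 x" | "X4 (- x) = - X4 x"

primcorec minus_hyp0 where
  "X1 (x - y) = X1 x - X1 y"
| "X2 (x - y) = X2 x - X2 y"
| "X3 (x - y) = X3 x - X3 y"
| "X4 (x - y) = X4 x - X4 y"

instance
  by standard (simp_all add: hyp0_eq_iff)

end

text \<open>The product is the bilinear extension of the multiplication table of the basis, which is
  recovered in \<open>hyp0_mult_table\<close> below.\<close>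

instantiation hyp0 :: ring_1
begin

primcorec one_hyp0 where
  "X1 1 = 1" | "X2 1 = 0" | "X3 1 = 0" | "X4 1 = 0"

primcorec times_hyp0 where
  "X1 (x * y) = X1 x * X1 y - X2 x * X2 y"
| "X2 (x * y) = X1 x * X2 y + X2 x * X1 y"
| "X3 (x * y) = X1 x * X3 y + X3 x * X1 y - X2 x * X4 y + X4 x * X2 y"
| "X4 (x * y) = X1 x * X4 y + X4 x * X1 y + X2 x * X3 y - X3 x * X2 y"

instance
  by standard (simp_all add: hyp0_eq_iff algebra_simps)

end

instantiation hyp0 :: real_algebra_1
begin

primcorec scaleR_hyp0 where
  "X1 (scaleR r x) = r * X1 x"
| "X2 (scaleR r x) = r * X2 x"
| "X3 (scaleR r x) = r * X3 x"
| "X4 (scaleR r x) = r * X4 x"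

instance
  by standard (simp_all add: hyp0_eq_iff algebra_simps)

end

definition hi :: hyp0 where "hi = H0 0 1 0 0"
definition hj :: hyp0 where "hj = H0 0 0 1 0"
definition hk :: hyp0 where "hk = H0 0 0 0 1"

lemma hyp0_basis_sel [simp]:
  "X1 hi = 0" "X2 hi = 1" "X3 hi = 0" "X4 hi = 0"
  "X1 hj = 0" "X2 hj = 0" "X3 hj = 1" "X4 hj = 0"
  "X1 hk = 0" "X2 hk = 0" "X3 hk = 0" "X4 hk = 1"
  by (simp_all add: hi_def hj_def hk_def)

lemma hyp0_basis_expansion:
  "w = X1 w *\<^sub>R 1 + X2 w *\<^sub>R hi + X3 w *\<^sub>R hj + X4 w *\<^sub>R hk"
  by (simp add: hyp0_eq_iff)

lemma hyp0_mult_table: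
  "hi * hi = - 1"  "hi * hj = hk"    "hi * hk = - hj"
  "hj * hi = - hk" "hj * hj = 0"     "hj * hk = 0"
  "hk * hi = hj"   "hk * hj = 0"     "hk * hk = 0"
  by (simp_all add: hyp0_eq_iff)


section \<open>Identification with $\mathbf{R}^4$\<close>

text \<open>The Euclidean norm is not submultiplicative for the product above, so the type is not an
  instance of \<^class>\<open>real_normed_algebra\<close>.\<close>

instantiation hyp0 :: real_inner
begin

definition inner_hyp0_def:
  "inner x y = X1 x * X1 y + X2 x * X2 y + X3 x * X3 y + X4 x * X4 y"

definition norm_hyp0_def: "norm (x :: hyp0) = sqrt (inner x x)"

definition sgn_hyp0_def: "sgn (x :: hyp0) = x /\<^sub>R norm x"

definition dist_hyp0_def: "dist x y = norm (x - y :: hyp0)"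

definition uniformity_hyp0_def [code del]:
  "(uniformity :: (hyp0 \<times> hyp0) filter) = (INF e\<in>{0 <..}. principal {(x, y). dist x y < e})"

definition open_hyp0_def [code del]:
  "open (U :: hyp0 set) \<longleftrightarrow> (\<forall>x\<in>U. eventually (\<lambda>(x', y). x' = x \<longrightarrow> y \<in> U) uniformity)"

instance
proof
  fix x y z :: hyp0 and r :: real and U :: "hyp0 set"
  show "dist x y = norm (x - y)" by (rule dist_hyp0_def)
  show "sgn x = x /\<^sub>R norm x" by (rule sgn_hyp0_def)
  show "(uniformity :: (hyp0 \<times> hyp0) filter) = (INF e\<in>{0 <..}. principal {(x, y). dist x y < e})"
    by (rule uniformity_hyp0_def)
  show "open U \<longleftrightarrow> (\<forall>x\<in>U. eventually (\<lambda>(x', y). x' = x \<longrightarrow> y \<in> U) uniformity)"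
    by (rule open_hyp0_def)
  show "inner x y = inner y x"
    by (simp add: inner_hyp0_def mult.commute)
  show "inner (x + y) z = inner x z + inner y z"
    by (simp add: inner_hyp0_def algebra_simps)
  show "inner (scaleR r x) y = r * inner x y"
    by (simp add: inner_hyp0_def algebra_simps)
  show "0 \<le> inner x x"
    by (simp add: inner_hyp0_def)
  show "inner x x = 0 \<longleftrightarrow> x = 0"
    by (simp add: inner_hyp0_def hyp0_eq_iff add_nonneg_eq_0_iff)
  show "norm x = sqrt (inner x x)" by (rule norm_hyp0_def)
qed

end

instantiation hyp0 :: euclidean_space
begin

definition Basis_hyp0_def: "Basis = {1, hi, hj, hk}"

instance
proof
  fix u v x :: hyp0
  show "(Basis :: hyp0 set) \<noteq> {}" "finite (Basis :: hyp0 set)"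
    by (simp_all add: Basis_hyp0_def)
  have neq: "(1::hyp0) \<noteq> hi" "(1::hyp0) \<noteq> hj" "(1::hyp0) \<noteq> hk" "hi \<noteq> hj" "hi \<noteq> hk" "hj \<noteq> hk"
    by (simp_all add: hyp0_eq_iff)
  assume "u \<in> Basis" "v \<in> Basis"
  then show "inner u v = (if u = v then 1 else 0)"
    unfolding Basis_hyp0_def insert_iff empty_iff
    using neq neq[symmetric] by (elim disjE FalseE) (simp_all add: inner_hyp0_def)
next
  fix x :: hyp0
  show "(\<forall>u\<in>Basis. inner x u = 0) \<longleftrightarrow> x = 0"
    unfolding hyp0_eq_iff by (simp add: Basis_hyp0_def inner_hyp0_def)
qed

end


section \<open>Regular and harmonic functions\<close>

text \<open>The directions used below are the basis elements, so that \<open>pderiv_dir 1\<close>,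
  \<open>pderiv_dir hi\<close>, \<open>pderiv_dir hj\<close> and \<open>pderiv_dir hk\<close> are the partial derivatives with respect
  to $x_1, \dots, x_4$. They are meaningful only for functions that are differentiable, which the
  notions below therefore demand explicitly.\<close>

definition pderiv_dir :: "hyp0 \<Rightarrow> (hyp0 \<Rightarrow> hyp0) \<Rightarrow> hyp0 \<Rightarrow> hyp0" where
  "pderiv_dir e f w = vector_derivative (\<lambda>t. f (w + t *\<^sub>R e)) (at 0)"

definition nabla_left :: "(hyp0 \<Rightarrow> hyp0) \<Rightarrow> hyp0 \<Rightarrow> hyp0" where
  "nabla_left f w =
     pderiv_dir 1 f w + hi * pderiv_dir hi f w + hj * pderiv_dir hj f w + hk * pderiv_dir hk f w"

definition nabla_right :: "(hyp0 \<Rightarrow> hyp0) \<Rightarrow> hyp0 \<Rightarrow> hyp0" where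
  "nabla_right f w =
     pderiv_dir 1 f w + pderiv_dir hi f w * hi + pderiv_dir hj f w * hj + pderiv_dir hk f w * hk"

definition laplace0 :: "(hyp0 \<Rightarrow> hyp0) \<Rightarrow> hyp0 \<Rightarrow> hyp0" where
  "laplace0 f w = pderiv_dir 1 (pderiv_dir 1 f) w + pderiv_dir hi (pderiv_dir hi f) w"

definition regular0 :: "(hyp0 \<Rightarrow> hyp0) \<Rightarrow> bool" where
  "regular0 f \<longleftrightarrow>
     (\<forall>w. f differentiable (at w)) \<and>
     (\<forall>w. nabla_left f w = 0) \<and> (\<forall>w. nabla_right f w = 0)"

definition harmonic0 :: "(hyp0 \<Rightarrow> hyp0) \<Rightarrow> bool" where
  "harmonic0 f \<longleftrightarrow>
     (\<forall>w. f differentiable (at w)) \<and>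
     (\<forall>e\<in>Basis. \<forall>w. pderiv_dir e f differentiable (at w)) \<and>
     (\<forall>w. laplace0 f w = 0)"


section \<open>Symmetrized products\<close>

definition sym_prod :: "('a \<Rightarrow> hyp0) list \<Rightarrow> 'a \<Rightarrow> hyp0" where
  "sym_prod fs w =
     (1 / fact (length fs)) *\<^sub>R
       (\<Sum>\<sigma> | \<sigma> permutes {..<length fs}.
          prod_list (map (\<lambda>m. (fs ! \<sigma> m) w) [0..<length fs]))"

definition eta2 :: "hyp0 \<Rightarrow> hyp0" where
  "eta2 w = X2 w *\<^sub>R 1 - X1 w *\<^sub>R hi"

definition eta3 :: "hyp0 \<Rightarrow> hyp0" where
  "eta3 w = X3 w *\<^sub>R 1 - X1 w *\<^sub>R hj"

definition eta4 :: "hyp0 \<Rightarrow> hyp0" where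
  "eta4 w = X4 w *\<^sub>R 1 - X1 w *\<^sub>R hk"

definition eta_pow :: "nat \<times> nat \<times> nat \<Rightarrow> hyp0 \<Rightarrow> hyp0" where
  "eta_pow = (\<lambda>(n1, n2, n3) w.
     (1 / (fact n1 * fact n2 * fact n3)) *\<^sub>R
       sym_prod (replicate n1 eta2 @ replicate n2 eta3 @ replicate n3 eta4) w)"

end

theory Submission
  imports Defs "HOL-Combinatorics.Multiset_Permutations"
begin

text \<open>
  All three functions $\eta_2, \eta_3, \eta_4$ have the form $\zeta_e(w) = \langle w, e\rangle - x_1 e$
  with $e \in \{i, j_0, k_0\}$, so the symmetrized product is a multiple of the sum $S_A$, over all
  orderings of a finite index set $A$, of the products of the $\zeta_{e_x}(w)$. Expanding by the
  first factor gives $S_A = \sum_{x \in A} \zeta_{e_x} S_{A - \{x\}}$. The commutator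
  $[\zeta_a(v), \zeta_b(w)]$ plus the one with $a$ and $b$ exchanged vanishes, so in sums over pairs
  of indices the factors may be treated as commuting. By induction the derivative of $S_A$ in
  direction $v$ is $|A| \sum_x \zeta_{e_x}(v) S_{A - \{x\}} = |A| \sum_x S_{A - \{x\}} \zeta_{e_x}(v)$.
  Regularity is then
  $\zeta_e(1) + i \zeta_e(i) + j_0 \zeta_e(j_0) + k_0 \zeta_e(k_0) = -e + e = 0$, and harmonicity is
  the vanishing of the symmetrization of $\zeta_a(1) \zeta_b(1) + \zeta_a(i) \zeta_b(i)$ in $a$ and $b$.
\<close>

section \<open>Differential calculus for the product\<close>

lemma bounded_bilinear_times_hyp0: "bounded_bilinear ((*) :: hyp0 \<Rightarrow> hyp0 \<Rightarrow> hyp0)"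
  by (rule bilinear_conv_bounded_bilinear[THEN iffD1])
    (auto simp: bilinear_def linear_iff algebra_simps)

text \<open>The product rule comes from bilinearity, which in finite dimension implies boundedness,
  because the norm is not submultiplicative.\<close>

lemmas has_derivative_times_hyp0 = bounded_bilinear.FDERIV[OF bounded_bilinear_times_hyp0]

lemma pderiv_dir_eq:
  assumes "(f has_derivative f') (at w)"
  shows "pderiv_dir e f w = f' e"
proof -
  have "((\<lambda>t. w + t *\<^sub>R e) has_derivative (\<lambda>t. t *\<^sub>R e)) (at 0)"
    by (auto intro!: derivative_eq_intros)
  then have "((\<lambda>t. f (w + t *\<^sub>R e)) has_derivative (\<lambda>t. f' (t *\<^sub>R e))) (at 0)"
    by (rule has_derivative_compose) (use assms in simp)
  moreover have "f' (t *\<^sub>R e) = t *\<^sub>R f' e" for t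
    using has_derivative_linear[OF assms] by (rule linear_scale)
  ultimately have "((\<lambda>t. f (w + t *\<^sub>R e)) has_vector_derivative f' e) (at 0)"
    by (simp add: has_vector_derivative_def)
  then show ?thesis
    unfolding pderiv_dir_def by (rule vector_derivative_at)
qed

lemma sum_pairs_swap:
  assumes "finite A"
  shows "(\<Sum>x\<in>A. \<Sum>y\<in>A - {x}. F x y) = (\<Sum>x\<in>A. \<Sum>y\<in>A - {x}. F y x)"
proof -
  have "A - {x} = {y \<in> A. y \<noteq> x}" for x by auto
  then show ?thesis
    using sum.swap_restrict[OF assms assms, of F "\<lambda>x y. y \<noteq> x"] by (simp add: eq_commute)
qed


section \<open>Linear factors and their quadratic identities\<close>

definition zeta :: "hyp0 \<Rightarrow> hyp0 \<Rightarrow> hyp0" where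
  "zeta e w = inner w e *\<^sub>R 1 - X1 w *\<^sub>R e"

lemma zeta_sel [simp]:
  "X1 (zeta e w) = inner w e - X1 w * X1 e"
  "X2 (zeta e w) = - X1 w * X2 e"
  "X3 (zeta e w) = - X1 w * X3 e"
  "X4 (zeta e w) = - X1 w * X4 e"
  by (simp_all add: zeta_def)

lemma eta_eq_zeta: "eta2 = zeta hi" "eta3 = zeta hj" "eta4 = zeta hk"
  by (simp_all add: fun_eq_iff zeta_def eta2_def eta3_def eta4_def inner_hyp0_def)

lemma bounded_linear_zeta: "bounded_linear (zeta e)"
  by (rule linear_conv_bounded_linear[THEN iffD1])
    (auto simp: linear_iff zeta_def algebra_simps)

text \<open>The commutator of \<open>zeta a v\<close> and \<open>zeta b w\<close> is
  \<open>X1 v * X1 w\<close> times that of \<open>a\<close> and \<open>b\<close>, hence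
  antisymmetric in \<open>a\<close> and \<open>b\<close>.\<close>

lemma zeta_commute_sym:
  "zeta a v * zeta b w + zeta b v * zeta a w = zeta b w * zeta a v + zeta a w * zeta b v"
  by (simp add: hyp0_eq_iff algebra_simps)

lemma zeta_nabla:
  assumes "X1 e = 0"
  shows "zeta e 1 + hi * zeta e hi + hj * zeta e hj + hk * zeta e hk = 0"
    and "zeta e 1 + zeta e hi * hi + zeta e hj * hj + zeta e hk * hk = 0"
  using assms by (simp_all add: hyp0_eq_iff inner_hyp0_def)

text \<open>Here \<open>zeta a 1 = - a\<close> and \<open>zeta a hi\<close> is the real number
  \<open>X2 a\<close>. For imaginary \<open>a\<close> and \<open>b\<close> one has a b + b a = -2
  \<open>X2 a * X2 b\<close>, which cancels the two real products.\<close>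

lemma zeta_laplace:
  assumes "X1 a = 0" "X1 b = 0"
  shows "(zeta a 1 * zeta b 1 + zeta a hi * zeta b hi) +
         (zeta b 1 * zeta a 1 + zeta b hi * zeta a hi) = 0"
  using assms by (simp add: hyp0_eq_iff inner_hyp0_def algebra_simps)


section \<open>Sums over all orderings and their derivatives\<close>

definition sym_sum :: "('b \<Rightarrow> hyp0) \<Rightarrow> 'b set \<Rightarrow> hyp0 \<Rightarrow> hyp0" where
  "sym_sum E A w = (\<Sum>xs\<in>permutations_of_set A. prod_list (map (\<lambda>x. zeta (E x) w) xs))"

lemma sym_sum_empty [simp]: "sym_sum E {} w = 1"
  by (simp add: sym_sum_def)

lemma sym_sum_rec:
  assumes "finite A" "A \<noteq> {}"
  shows "sym_sum E A w = (\<Sum>x\<in>A. zeta (E x) w * sym_sum E (A - {x}) w)"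
  unfolding sym_sum_def permutations_of_set_nonempty[OF assms(2)]
  using assms(1)
  by (subst sum.UNION_disjoint) (auto simp: sum.reindex sum_distrib_left)

text \<open>A singleton is excluded because the empty sum on the left is 0, while
  \<open>sym_sum E {} w\<close> is 1.\<close>

lemma sym_sum_remove_rec:
  assumes "finite A" "\<not> is_singleton A" "x \<in> A"
  shows "(\<Sum>y\<in>A - {x}. zeta (E y) w * sym_sum E (A - {x} - {y}) w) = sym_sum E (A - {x}) w"
proof -
  have "A - {x} \<noteq> {}"
    using assms(2,3) by (auto simp: is_singleton_def)
  then show ?thesis
    using sym_sum_rec[of "A - {x}" E w] assms(1) by simp
qed

lemma zeta_sum_swap:
  assumes "finite A" and sym: "\<And>x y. T x y = T y x"
  shows "(\<Sum>x\<in>A. \<Sum>y\<in>A - {x}. zeta (E x) v * (zeta (E y) w * T x y)) =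
         (\<Sum>x\<in>A. \<Sum>y\<in>A - {x}. zeta (E x) w * (zeta (E y) v * T x y))"
    (is "?L = ?R")
proof -
  define F where "F x y = zeta (E x) v * (zeta (E y) w * T x y)" for x y
  define G where "G x y = zeta (E x) w * (zeta (E y) v * T x y)" for x y
  \<comment> \<open>Only the symmetrized terms agree; the symmetry of \<open>T\<close> makes it a
    common right factor.\<close>
  have "F x y + F y x = G x y + G y x" for x y
    using arg_cong[OF zeta_commute_sym[of "E x" v "E y" w], of "\<lambda>c. c * T x y"] sym[of x y]
    by (simp add: F_def G_def algebra_simps)
  then have "(\<Sum>x\<in>A. \<Sum>y\<in>A - {x}. F x y + F y x) = (\<Sum>x\<in>A. \<Sum>y\<in>A - {x}. G x y + G y x)"
    by simp
  then have "?L + ?L = ?R + ?R"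
    using sum_pairs_swap[OF assms(1), of F] sum_pairs_swap[OF assms(1), of G]
    by (simp add: sum.distrib F_def G_def)
  then have "2 *\<^sub>R ?L = 2 *\<^sub>R ?R"
    by (simp only: scaleR_2)
  then show ?thesis by simp
qed

text \<open>Moves the direction \<open>v\<close> from the second factor to the first. This is what
  lets the terms of the product rule be collected.\<close>

lemma zeta_sym_sum_swap:
  assumes "finite A"
  shows "(\<Sum>x\<in>A. zeta (E x) w * (\<Sum>y\<in>A - {x}. zeta (E y) v * sym_sum E (A - {x} - {y}) w)) =
         (if is_singleton A then 0 else \<Sum>x\<in>A. zeta (E x) v * sym_sum E (A - {x}) w)"
proof (cases "is_singleton A")
  case False
  have "(\<Sum>x\<in>A. zeta (E x) v * sym_sum E (A - {x}) w) =
        (\<Sum>x\<in>A. \<Sum>y\<in>A - {x}. zeta (E x) v * (zeta (E y) w * sym_sum E (A - {x} - {y}) w))"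
    using sym_sum_remove_rec[OF assms False] by (simp flip: sum_distrib_left)
  also have "\<dots> = (\<Sum>x\<in>A. \<Sum>y\<in>A - {x}. zeta (E x) w * (zeta (E y) v * sym_sum E (A - {x} - {y}) w))"
    by (rule zeta_sum_swap[OF assms]) (simp add: Diff_insert2[symmetric] insert_commute)
  finally show ?thesis
    using False by (simp add: sum_distrib_left)
qed (auto simp: is_singleton_def)

text \<open>Provides the second form of the derivative, needed for \<open>nabla_right\<close>. The
  factor at \<open>v\<close> goes from first to second place, then to the end by induction; the
  remaining factors are reassembled after renaming the indices.\<close>

lemma zeta_sym_sum_commute:
  assumes "finite A"
  shows "(\<Sum>x\<in>A. zeta (E x) v * sym_sum E (A - {x}) w) =
         (\<Sum>x\<in>A. sym_sum E (A - {x}) w * zeta (E x) v)"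
  using assms
proof (induction A rule: finite_psubset_induct)
  case (psubset A)
  show ?case
  proof (cases "is_singleton A")
    case False
    have "(\<Sum>x\<in>A. zeta (E x) v * sym_sum E (A - {x}) w) =
      (\<Sum>x\<in>A. zeta (E x) w * (\<Sum>y\<in>A - {x}. zeta (E y) v * sym_sum E (A - {x} - {y}) w))"
      using zeta_sym_sum_swap[OF psubset.hyps, of E w v] False by simp
    also have "\<dots> = (\<Sum>x\<in>A. zeta (E x) w * (\<Sum>y\<in>A - {x}. sym_sum E (A - {x} - {y}) w * zeta (E y) v))"
      by (intro sum.cong refl arg_cong2[where f = "(*)"] psubset.IH) auto
    also have "\<dots> = (\<Sum>x\<in>A. \<Sum>y\<in>A - {x}. zeta (E x) w * sym_sum E (A - {x} - {y}) w * zeta (E y) v)"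
      by (simp add: sum_distrib_left mult.assoc)
    also have "\<dots> = (\<Sum>x\<in>A. \<Sum>y\<in>A - {x}. zeta (E y) w * sym_sum E (A - {y} - {x}) w * zeta (E x) v)"
      by (rule sum_pairs_swap[OF psubset.hyps])
    also have "\<dots> = (\<Sum>x\<in>A. (\<Sum>y\<in>A - {x}. zeta (E y) w * sym_sum E (A - {x} - {y}) w) * zeta (E x) v)"
      by (simp add: sum_distrib_right Diff_insert2[symmetric] insert_commute)
    also have "\<dots> = (\<Sum>x\<in>A. sym_sum E (A - {x}) w * zeta (E x) v)"
      using sym_sum_remove_rec[OF psubset.hyps False] by simp
    finally show ?thesis .
  qed (auto simp: is_singleton_def)
qed

lemma has_derivative_sym_sum:
  assumes "finite A"
  shows "(sym_sum E A has_derivative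
           (\<lambda>v. real (card A) *\<^sub>R (\<Sum>x\<in>A. zeta (E x) v * sym_sum E (A - {x}) w))) (at w)"
  using assms
proof (induction A rule: finite_psubset_induct)
  case (psubset A)
  show ?case
  proof (cases "A = {}")
    case True
    then have "sym_sum E A = (\<lambda>w. 1)" by auto
    then show ?thesis using True by simp
  next
    case False
    let ?D = "\<lambda>v. \<Sum>x\<in>A. zeta (E x) v * sym_sum E (A - {x}) w"
    let ?D2 = "\<lambda>x v. real (card (A - {x})) *\<^sub>R
                 (\<Sum>y\<in>A - {x}. zeta (E y) v * sym_sum E (A - {x} - {y}) w)"
    have "((\<lambda>w. \<Sum>x\<in>A. zeta (E x) w * sym_sum E (A - {x}) w) has_derivative
      (\<lambda>v. \<Sum>x\<in>A. zeta (E x) w * ?D2 x v + zeta (E x) v * sym_sum E (A - {x}) w)) (at w)"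
      by (intro has_derivative_sum has_derivative_times_hyp0 psubset.IH
          bounded_linear_imp_has_derivative bounded_linear_zeta) auto
    moreover have "(\<Sum>x\<in>A. zeta (E x) w * ?D2 x v + zeta (E x) v * sym_sum E (A - {x}) w) =
        real (card A) *\<^sub>R ?D v" for v
    proof -
      have card: "card (A - {x}) = card A - 1" if "x \<in> A" for x
        using that by simp
      have "(\<Sum>x\<in>A. zeta (E x) w * ?D2 x v) = real (card A - 1) *\<^sub>R
        (\<Sum>x\<in>A. zeta (E x) w * (\<Sum>y\<in>A - {x}. zeta (E y) v * sym_sum E (A - {x} - {y}) w))"
        using card by (simp add: scaleR_sum_right sum_distrib_left)
      \<comment> \<open>For a singleton both sides vanish, since \<open>card A - 1\<close> is
        0.\<close>
      also have "\<dots> = real (card A - 1) *\<^sub>R ?D v"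
        using zeta_sym_sum_swap[OF psubset.hyps, of E w v]
        by (auto simp: is_singleton_altdef)
      finally have *: "(\<Sum>x\<in>A. zeta (E x) w * ?D2 x v) = real (card A - 1) *\<^sub>R ?D v" .
      have "real (card A) = real (card A - 1) + 1"
        using False psubset.hyps by (simp add: card_gt_0_iff of_nat_diff Suc_leI)
      then show ?thesis
        by (simp only: sum.distrib * scaleR_add_left scaleR_one)
    qed
    moreover have "sym_sum E A = (\<lambda>w. \<Sum>x\<in>A. zeta (E x) w * sym_sum E (A - {x}) w)"
      using sym_sum_rec[OF psubset.hyps False] by auto
    ultimately show ?thesis by simp
  qed
qed

lemma sym_prod_zeta:
  "sym_prod (map zeta es) w =
     (1 / fact (length es)) *\<^sub>R sym_sum ((!) es) {..<length es} w"
proof -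
  let ?n = "length es"
  let ?h = "\<lambda>\<sigma>. map \<sigma> [0..<?n]"
  have inj: "inj_on ?h {\<sigma>. \<sigma> permutes {..<?n}}"
  proof (rule inj_onI)
    fix \<sigma> \<tau> :: "nat \<Rightarrow> nat"
    assume *: "\<sigma> \<in> {\<sigma>. \<sigma> permutes {..<?n}}" "\<tau> \<in> {\<sigma>. \<sigma> permutes {..<?n}}" "?h \<sigma> = ?h \<tau>"
    show "\<sigma> = \<tau>"
    proof
      fix m
      show "\<sigma> m = \<tau> m"
        using * by (cases "m < ?n") (auto simp: permutes_def)
    qed
  qed
  have "?h ` {\<sigma>. \<sigma> permutes {..<?n}} \<subseteq> permutations_of_set {..<?n}"
  proof clarify
    fix \<sigma> assume \<sigma>: "\<sigma> permutes {..<?n}"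
    then show "?h \<sigma> \<in> permutations_of_set {..<?n}"
      using permutes_image[OF \<sigma>] permutes_inj_on[OF \<sigma>]
      by (auto simp: permutations_of_set_def distinct_map atLeast0LessThan)
  qed
  \<comment> \<open>Surjectivity follows by counting: both sets have n! elements.\<close>
  then have "?h ` {\<sigma>. \<sigma> permutes {..<?n}} = permutations_of_set {..<?n}"
    by (intro card_subset_eq) (simp_all add: card_image[OF inj] card_permutations)
  with inj have "bij_betw ?h {\<sigma>. \<sigma> permutes {..<?n}} (permutations_of_set {..<?n})"
    by (simp add: bij_betw_def)
  from sum.reindex_bij_betw[OF this, of "\<lambda>xs. prod_list (map (\<lambda>x. zeta (es ! x) w) xs)"]
  have "sym_sum ((!) es) {..<?n} w =
      (\<Sum>\<sigma> | \<sigma> permutes {..<?n}. prod_list (map (\<lambda>m. zeta (es ! \<sigma> m) w) [0..<?n]))"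
    by (simp add: sym_sum_def comp_def)
  also have "\<dots> = (\<Sum>\<sigma> | \<sigma> permutes {..<?n}.
      prod_list (map (\<lambda>m. (map zeta es ! \<sigma> m) w) [0..<?n]))"
  proof (intro sum.cong refl arg_cong[where f = prod_list] map_cong)
    fix \<sigma> m assume "\<sigma> \<in> {\<sigma>. \<sigma> permutes {..<?n}}" "m \<in> set [0..<?n]"
    then have "\<sigma> m < ?n"
      using permutes_in_image[of \<sigma> "{..<?n}" m] by simp
    then show "zeta (es ! \<sigma> m) w = (map zeta es ! \<sigma> m) w" by simp
  qed
  finally show ?thesis
    by (simp add: sym_prod_def)
qed


section \<open>Regularity and harmonicity\<close>

lemma regular0_sym_sum:
  assumes "finite A" and E: "\<And>x. x \<in> A \<Longrightarrow> X1 (E x) = 0"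
  shows "regular0 (\<lambda>w. c *\<^sub>R sym_sum E A w)"
proof -
  let ?f = "\<lambda>w. c *\<^sub>R sym_sum E A w" and ?S = "\<lambda>x. sym_sum E (A - {x})"
  let ?r = "c * real (card A)"
  have deriv: "(?f has_derivative (\<lambda>v. ?r *\<^sub>R (\<Sum>x\<in>A. zeta (E x) v * ?S x w))) (at w)" for w
    using has_derivative_scaleR_right[OF has_derivative_sym_sum[OF assms(1)], of c] by simp
  note pd = pderiv_dir_eq[OF deriv]
  have "nabla_left ?f w = ?r *\<^sub>R (\<Sum>x\<in>A.
      (zeta (E x) 1 + hi * zeta (E x) hi + hj * zeta (E x) hj + hk * zeta (E x) hk) * ?S x w)" for w
    unfolding nabla_left_def pd
    by (simp add: sum.distrib sum_distrib_left distrib_right scaleR_add_right mult.assoc)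
  then have "nabla_left ?f w = 0" for w
    using E by (simp add: zeta_nabla)
  \<comment> \<open>With the linear factor moved to the right end, it stands next to the basis
    element multiplied from the right.\<close>
  moreover have "nabla_right ?f w = ?r *\<^sub>R (\<Sum>x\<in>A. ?S x w *
      (zeta (E x) 1 + zeta (E x) hi * hi + zeta (E x) hj * hj + zeta (E x) hk * hk))" for w
    unfolding nabla_right_def pd zeta_sym_sum_commute[OF assms(1)]
    by (simp add: sum.distrib sum_distrib_right distrib_left scaleR_add_right mult.assoc)
  then have "nabla_right ?f w = 0" for w
    using E by (simp add: zeta_nabla)
  ultimately show ?thesis
    using deriv unfolding regular0_def differentiable_def by blast
qed

lemma harmonic0_sym_sum:
  assumes "finite A" and E: "\<And>x. x \<in> A \<Longrightarrow> X1 (E x) = 0"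
  shows "harmonic0 (\<lambda>w. c *\<^sub>R sym_sum E A w)"
proof -
  let ?f = "\<lambda>w. c *\<^sub>R sym_sum E A w" and ?S = "\<lambda>x. sym_sum E (A - {x})"
  let ?r = "c * real (card A)" and ?q = "c * real (card A) * real (card A - 1)"
  let ?T = "\<lambda>x y. sym_sum E (A - {x} - {y})"
  have deriv: "(?f has_derivative (\<lambda>v. ?r *\<^sub>R (\<Sum>x\<in>A. zeta (E x) v * ?S x w))) (at w)" for w
    using has_derivative_scaleR_right[OF has_derivative_sym_sum[OF assms(1)], of c] by simp
  have pd: "pderiv_dir v ?f = (\<lambda>w. ?r *\<^sub>R (\<Sum>x\<in>A. zeta (E x) v * ?S x w))" for v
    by (rule ext) (rule pderiv_dir_eq[OF deriv])
  \<comment> \<open>For fixed \<open>v\<close> the factor \<open>zeta (E x) v\<close> is constant in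
    \<open>w\<close>, so only \<open>?S x\<close> is differentiated.\<close>
  have deriv2: "(pderiv_dir v ?f has_derivative (\<lambda>u. ?r *\<^sub>R (\<Sum>x\<in>A. zeta (E x) v *
      (real (card (A - {x})) *\<^sub>R (\<Sum>y\<in>A - {x}. zeta (E y) u * ?T x y w))))) (at w)" for v w
    unfolding pd
    by (intro has_derivative_scaleR_right has_derivative_sum has_derivative_sym_sum
        bounded_linear.has_derivative[OF bounded_bilinear.bounded_linear_right[OF
            bounded_bilinear_times_hyp0]]) (use assms(1) in simp)
  have pd2: "pderiv_dir v (pderiv_dir v ?f) w = ?q *\<^sub>R
      (\<Sum>x\<in>A. \<Sum>y\<in>A - {x}. zeta (E x) v * zeta (E y) v * ?T x y w)" for v w
    unfolding pderiv_dir_eq[OF deriv2]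
    by (simp add: scaleR_sum_right sum_distrib_left mult.assoc)
  have "laplace0 ?f w = 0" for w
  proof -
    define G where "G x y =
      (zeta (E x) 1 * zeta (E y) 1 + zeta (E x) hi * zeta (E y) hi) * ?T x y w" for x y
    let ?L = "\<Sum>x\<in>A. \<Sum>y\<in>A - {x}. G x y"
    \<comment> \<open>The terms of the Laplacian cancel in pairs, not one by one.\<close>
    have "G x y + G y x = 0" if "x \<in> A" "y \<in> A" for x y
    proof -
      have "?T y x = ?T x y"
        by (simp add: Diff_insert2[symmetric] insert_commute)
      then have "G x y + G y x = ((zeta (E x) 1 * zeta (E y) 1 + zeta (E x) hi * zeta (E y) hi) +
          (zeta (E y) 1 * zeta (E x) 1 + zeta (E y) hi * zeta (E x) hi)) * ?T x y w"
        by (simp add: G_def distrib_right)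
      then show ?thesis
        using that E by (simp only: zeta_laplace) simp
    qed
    then have "(\<Sum>x\<in>A. \<Sum>y\<in>A - {x}. G x y + G y x) = 0"
      by (simp add: sum.neutral)
    then have "?L + ?L = 0"
      using sum_pairs_swap[OF assms(1), of G] by (simp add: sum.distrib)
    then have "?L = 0"
      by (simp flip: scaleR_2)
    moreover have "laplace0 ?f w = ?q *\<^sub>R ?L"
      unfolding laplace0_def pd2
      by (simp add: G_def sum.distrib distrib_right scaleR_add_right)
    ultimately show ?thesis by simp
  qed
  then show ?thesis
    using deriv deriv2 unfolding harmonic0_def differentiable_def by blast
qed

theorem theorem52:
  fixes n :: "nat \<times> nat \<times> nat"
  shows "harmonic0 (eta_pow n) \<and> regular0 (eta_pow n)"
proof -
  obtain n1 n2 n3 where n: "n = (n1, n2, n3)" by (cases n)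
  \<comment> \<open>The index set consists of positions in \<open>es\<close>, so that equal factors
    stay distinct.\<close>
  define es where "es = replicate n1 hi @ replicate n2 hj @ replicate n3 hk"
  have "map zeta es = replicate n1 eta2 @ replicate n2 eta3 @ replicate n3 eta4"
    by (simp add: es_def eta_eq_zeta)
  then have eq: "eta_pow n = (\<lambda>w. (1 / (fact n1 * fact n2 * fact n3) * (1 / fact (length es))) *\<^sub>R
      sym_sum ((!) es) {..<length es} w)"
    using sym_prod_zeta[of es] by (auto simp: eta_pow_def n)
  have "X1 (es ! m) = 0" if "m \<in> {..<length es}" for m
  proof -
    have "es ! m \<in> set es" using that by simp
    also have "set es \<subseteq> {hi, hj, hk}" by (auto simp: es_def)
    finally show ?thesis by auto
  qed
  then show ?thesis
    unfolding eq by (auto intro!: regular0_sym_sum harmonic0_sym_sum)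
qed

end
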